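(* Let $f\in\mathcal{S}$ have the expansion $f(z)=z+a_2z^2+a_3z^3+\cdots$ with $a_2=0$. Then (i) $|T_{3,2}(f)|\le \frac43$; (ii) $|T_{3,3}(f)|\le 7.3883\ldots$, i.e. there is an absolute constant $C$ with $7.3883\le C<7.3884$ such that $|T_{3,3}(f)|\le C$ for every $f\in\mathcal{S}$ with $a_2=0$.
   Context: Let $\mathbb{D}=\{z\in\mathbb{C}:|z|<1\}$ and let $\mathcal{A}$ be the class of analytic functions $f$ in $\mathbb{D}$ with $f(0)=f'(0)-1=0$, i.e. $f(z)=z+a_2z^2+a_3z^3+\cdots$; put $a_1=1$. The class $\mathcal{S}$ consists of all $f\in\mathcal{A}$ that are univalent (injective) in $\mathbb{D}$. For integers $q,n\ge 1$, the symmetric Toeplitz determinant $T_{q,n}(f)$ is the determinant of the $q\times q$ matrix whose $(i,j)$ entry is $a_{n+|i-j|}$. In particular $T_{3,2}(f)=(a_2-a_4)(a_2^2-2a_3^2+a_2a_4)$ and $T_{3,3}(f)=(a_3-a_5)(a_3^2-2a_4^2+a_3a_5)$. *)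

theory Defs
  imports "HOL-Complex_Analysis.Complex_Analysis" "Jordan_Normal_Form.Determinant"
begin

abbreviation unit_disc :: "complex set" where
  "unit_disc \<equiv> ball 0 1"

(* Functions are total in HOL, so values outside the unit disc are left unconstrained. *)
definition class_A :: "(complex \<Rightarrow> complex) set" where
  "class_A = {f. f holomorphic_on unit_disc \<and> f 0 = 0 \<and> deriv f 0 = 1}"

definition class_S :: "(complex \<Rightarrow> complex) set" where
  "class_S = {f \<in> class_A. inj_on f unit_disc}"

definition taylor_coeff :: "(complex \<Rightarrow> complex) \<Rightarrow> nat \<Rightarrow> complex" where
  "taylor_coeff f k = (deriv ^^ k) f 0 / fact k"

(* The index offset is |i - j|; the second summand is 0 when i >= j and the first when i <= j,
   since subtraction on nat truncates. Rows and columns are numbered from 0. *)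
definition toeplitz_mat :: "nat \<Rightarrow> nat \<Rightarrow> (complex \<Rightarrow> complex) \<Rightarrow> complex mat" where
  "toeplitz_mat q n f = mat q q (\<lambda>(i, j). taylor_coeff f (n + ((i - j) + (j - i))))"

definition toeplitz_det :: "nat \<Rightarrow> nat \<Rightarrow> (complex \<Rightarrow> complex) \<Rightarrow> complex" where
  "toeplitz_det q n f = Determinant.det (toeplitz_mat q n f)"

end

theory Submission
  imports Defs
begin

text \<open>
  Let \<open>f\<close> be univalent with \<open>a\<^sub>2 = 0\<close>. Its reciprocal \<open>g = 1 / f\<close> is injective on the punctured disc and
  has the Laurent expansion \<open>1 / z - a\<^sub>3 z - a\<^sub>4 z\<^sup>2 - (a\<^sub>5 - a\<^sub>3\<^sup>2) z\<^sup>3 + \<dots>\<close>. Gronwall's area theorem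
  (\<open>area_theorem\<close>) says that \<open>\<Sum> n \<bar>b\<^sub>n\<bar>\<^sup>2 \<le> 1\<close> for the coefficients \<open>b\<^sub>n\<close> of such a function, so
  \<open>\<bar>a\<^sub>3\<bar>\<^sup>2 + 2 \<bar>a\<^sub>4\<bar>\<^sup>2 + 3 \<bar>a\<^sub>5 - a\<^sub>3\<^sup>2\<bar>\<^sup>2 \<le> 1\<close> (\<open>class_S_coefficient_bound\<close>). The first determinant is
  \<open>2 a\<^sub>3\<^sup>2 a\<^sub>4\<close> and the second one is \<open>(a\<^sub>3 - a\<^sub>5) (a\<^sub>3\<^sup>2 - 2 a\<^sub>4\<^sup>2 + a\<^sub>3 a\<^sub>5)\<close>; this joint constraint on
  the coefficients bounds both by elementary estimates.

  The area theorem compares two estimates of the area of the image under \<open>g = 1 / z + h z\<close> of an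
  annulus \<open>e < \<bar>z\<bar> < b\<close>, with \<open>e\<close> small and \<open>b\<close> close to one. From below, the area is the integral of
  \<open>\<bar>g' z\<bar>\<^sup>2\<close>, because \<open>g\<close> is injective, and the orthogonality of the powers of \<open>z\<close> on the annulus
  expresses it through the Laurent coefficients (\<open>area_annulus_laurent_ge\<close>). From above, the image
  avoids everything that \<open>g\<close> takes as a value in the punctured disc of radius \<open>e\<close>; this is all of the
  plane outside an ellipse that is almost the circle of radius \<open>1 / e\<close>
  (\<open>outside_ellipse_subset_image\<close>). The upper estimate is the area of that ellipse. It replaces
  the usual application of Green's formula to the image of a circle, so that neither the
  boundary curve nor its orientation has to be studied.
\<close>

section \<open>Area and holomorphic maps\<close>

text \<open>The change of variables theorem is stated for maps of \<open>real^'n\<close>. These two mutually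
  inverse linear maps carry it over to \<open>complex\<close>.\<close>
definition complex_of_vec :: "real^2 \<Rightarrow> complex" where
  "complex_of_vec v = Complex (vec_nth v 1) (vec_nth v 2)"

definition vec_of_complex :: "complex \<Rightarrow> real^2" where
  "vec_of_complex z = vector [Re z, Im z]"

lemma vec_of_complex_nth [simp]: "vec_nth (vec_of_complex z) 1 = Re z" "vec_nth (vec_of_complex z) 2 = Im z"
  by (simp_all add: vec_of_complex_def)

lemma Re_complex_of_vec [simp]: "Re (complex_of_vec v) = vec_nth v 1"
  and Im_complex_of_vec [simp]: "Im (complex_of_vec v) = vec_nth v 2"
  by (simp_all add: complex_of_vec_def)

lemma complex_of_vec_inverse [simp]: "complex_of_vec (vec_of_complex z) = z"
  by (simp add: complex_eq_iff)

lemma vec_of_complex_inverse [simp]: "vec_of_complex (complex_of_vec v) = v"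
  by (simp add: Finite_Cartesian_Product.vec_eq_iff forall_2)

lemma linear_complex_of_vec: "linear complex_of_vec"
  by (intro linearI) (simp_all add: complex_eq_iff)

lemma linear_vec_of_complex: "linear vec_of_complex"
  by (intro linearI) (simp_all add: Finite_Cartesian_Product.vec_eq_iff forall_2)

lemma open_vimage_complex_of_vec: "open S \<Longrightarrow> open (complex_of_vec -` S)"
  by (intro open_vimage linear_continuous_on linear_conv_bounded_linear[THEN iffD1] linear_complex_of_vec)

lemma measurable_complex_of_vec [measurable]: "complex_of_vec \<in> borel_measurable borel"
  by (intro borel_measurable_continuous_onI linear_continuous_on
        linear_conv_bounded_linear[THEN iffD1] linear_complex_of_vec)

lemma lborel_complex_eq_distr: "(lborel :: complex measure) = distr lborel borel complex_of_vec"
proof (rule lborel_eqI)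
  fix l u :: complex assume le: "\<And>b. b \<in> Basis \<Longrightarrow> l \<bullet> b \<le> u \<bullet> b"
  have eq: "complex_of_vec -` box l u = box (vec_of_complex l) (vec_of_complex u)"
    by (auto simp: mem_box_cart forall_2 in_box_complex_iff)
  have "emeasure (distr lborel borel complex_of_vec) (box l u)
        = emeasure lborel (box (vec_of_complex l) (vec_of_complex u))"
    by (subst emeasure_distr) (simp_all add: eq)
  also have "\<dots> = ennreal (\<Prod>b\<in>Basis. (vec_of_complex u - vec_of_complex l) \<bullet> b)"
  proof -
    have "vec_nth (vec_of_complex l) i \<le> vec_nth (vec_of_complex u) i" for i
      using le[of 1] le[of \<i>] exhaust_2[of i] by (auto simp: Basis_complex_def)
    thus ?thesis
      by (subst emeasure_lborel_box) (auto simp: Basis_vec_def inner_axis)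
  qed
  also have "(\<Prod>b\<in>Basis. (vec_of_complex u - vec_of_complex l) \<bullet> b) = (Re u - Re l) * (Im u - Im l)"
  proof -
    have *: "(Basis :: (real^2) set) = {axis 1 1, axis 2 1}"
      by (auto simp: Basis_vec_def UNIV_2)
    show ?thesis unfolding * by (simp add: inner_axis axis_eq_axis)
  qed
  also have "\<dots> = (\<Prod>b\<in>Basis. (u - l) \<bullet> b)"
    by (simp add: Basis_complex_def)
  finally show "emeasure (distr lborel borel complex_of_vec) (box l u) = (\<Prod>b\<in>Basis. (u - l) \<bullet> b)" .
qed simp

text \<open>The real-linear map \<open>u \<mapsto> \<alpha> u + \<beta> cnj u\<close>, the general form of a real derivative in the
  plane, is the composition of two rotations and an axis-parallel scaling by
  \<open>\<bar>\<alpha>\<bar> + \<bar>\<beta>\<bar>\<close> and \<open>\<bar>\<alpha>\<bar> - \<bar>\<beta>\<bar>\<close>; hence its Jacobian.\<close>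
lemma det_matrix_wirtinger:
  "Determinants.det (matrix (\<lambda>v. vec_of_complex (\<alpha> * complex_of_vec v + \<beta> * cnj (complex_of_vec v))))
   = (norm \<alpha>)\<^sup>2 - (norm \<beta>)\<^sup>2"
  unfolding cmod_power2 by (simp add: Determinants.det_2 matrix_def axis_def algebra_simps power2_eq_square)

lemma emeasure_lborel_complex:
  assumes "S \<in> sets (borel :: complex measure)"
  shows "emeasure lborel S = emeasure lborel (complex_of_vec -` S)"
  using assms by (subst lborel_complex_eq_distr, subst emeasure_distr) auto

text \<open>The change of variables formula for areas in the complex plane. The derivative is given in
  Wirtinger form so that two cases are covered at once: holomorphic maps (\<open>\<beta> = 0\<close>), and the
  real-linear maps that turn discs into the ellipses used in the area theorem.\<close>
lemma emeasure_image_wirtinger: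
  fixes g :: "complex \<Rightarrow> complex"
  assumes S: "open S" and gS: "open (g ` S)" and inj: "inj_on g S"
    and der: "\<And>z. z \<in> S \<Longrightarrow> (g has_derivative (\<lambda>u. \<alpha> z * u + \<beta> z * cnj u)) (at z)"
    and int: "set_integrable lborel S (\<lambda>z. \<bar>(norm (\<alpha> z))\<^sup>2 - (norm (\<beta> z))\<^sup>2\<bar>)"
  shows "emeasure lborel (g ` S) = ennreal (LINT z:S|lborel. \<bar>(norm (\<alpha> z))\<^sup>2 - (norm (\<beta> z))\<^sup>2\<bar>)"
proof -
  let ?J = "\<lambda>z. \<bar>(norm (\<alpha> z))\<^sup>2 - (norm (\<beta> z))\<^sup>2\<bar>"
  let ?T = "complex_of_vec -` S" and ?h = "\<lambda>v. vec_of_complex (g (complex_of_vec v))"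
  let ?h' = "\<lambda>x v. vec_of_complex (\<alpha> (complex_of_vec x) * complex_of_vec v
                     + \<beta> (complex_of_vec x) * cnj (complex_of_vec v))"
  have openT: "open ?T"
    using S by (rule open_vimage_complex_of_vec)
  have image: "?h ` ?T = complex_of_vec -` (g ` S)"
  proof (safe)
    fix v z assume "complex_of_vec v = g z" "z \<in> S"
    then show "v \<in> ?h ` ?T"
      by (intro image_eqI[of _ _ "vec_of_complex z"]) (auto simp flip: \<open>complex_of_vec v = g z\<close>)
  qed auto
  have openhT: "open (?h ` ?T)"
    unfolding image using gS by (rule open_vimage_complex_of_vec)
  have derh: "(?h has_derivative ?h' x) (at x within ?T)" if "x \<in> ?T" for x
  proof -
    have "(complex_of_vec has_derivative complex_of_vec) (at x within ?T)"
      by (simp add: linear_complex_of_vec linear_imp_has_derivative)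
    moreover have "(g has_derivative (\<lambda>u. \<alpha> (complex_of_vec x) * u + \<beta> (complex_of_vec x) * cnj u))
       (at (complex_of_vec x) within complex_of_vec ` ?T)"
      using der[of "complex_of_vec x"] that by (auto intro: has_derivative_at_withinI)
    ultimately have "(g \<circ> complex_of_vec has_derivative
        (\<lambda>u. \<alpha> (complex_of_vec x) * u + \<beta> (complex_of_vec x) * cnj u) \<circ> complex_of_vec) (at x within ?T)"
      by (rule diff_chain_within)
    moreover have "(vec_of_complex has_derivative vec_of_complex)
       (at ((g \<circ> complex_of_vec) x) within (g \<circ> complex_of_vec) ` ?T)"
      by (simp add: linear_vec_of_complex linear_imp_has_derivative)
    ultimately show ?thesis
      using diff_chain_within by (fastforce simp: o_def)
  qed
  have injh: "inj_on ?h ?T"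
  proof (rule inj_onI)
    fix x y assume "x \<in> ?T" "y \<in> ?T" "?h x = ?h y"
    then have "g (complex_of_vec x) = g (complex_of_vec y)"
      by (metis complex_of_vec_inverse)
    then have "complex_of_vec x = complex_of_vec y"
      using inj \<open>x \<in> ?T\<close> \<open>y \<in> ?T\<close> by (auto dest: inj_onD)
    then show "x = y"
      by (metis vec_of_complex_inverse)
  qed
  have intT: "set_integrable lborel ?T (\<lambda>v. ?J (complex_of_vec v))"
    and LINT: "(LINT z:S|lborel. ?J z) = (LINT v:?T|lborel. ?J (complex_of_vec v))"
  proof -
    have ind: "indicator ?T v = (indicator S (complex_of_vec v) :: real)" for v
      by (simp add: indicator_def)
    from int have *: "integrable (distr lborel borel complex_of_vec) (\<lambda>z. indicator S z *\<^sub>R ?J z)"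
      unfolding set_integrable_def by (subst (asm) lborel_complex_eq_distr)
    have meas: "(\<lambda>z. indicator S z *\<^sub>R ?J z) \<in> borel_measurable borel"
      using borel_measurable_integrable[OF *] by simp
    have "integrable lborel (\<lambda>v. indicator S (complex_of_vec v) *\<^sub>R ?J (complex_of_vec v))"
      using * meas by (subst (asm) integrable_distr_eq) auto
    then show "set_integrable lborel ?T (\<lambda>v. ?J (complex_of_vec v))"
      unfolding set_integrable_def ind .
    show "(LINT z:S|lborel. ?J z) = (LINT v:?T|lborel. ?J (complex_of_vec v))"
      unfolding set_lebesgue_integral_def ind
      by (subst lborel_complex_eq_distr, subst integral_distr) (use meas in auto)
  qed
  have "((\<lambda>v. ?J (complex_of_vec v)) has_integral (LINT v:?T|lborel. ?J (complex_of_vec v))) ?T"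
    using set_borel_integral_eq_integral[OF intT] by (simp add: has_integral_iff)
  hence "((\<lambda>v. \<bar>Determinants.det (matrix (?h' v))\<bar>) has_integral (LINT v:?T|lborel. ?J (complex_of_vec v))) ?T"
    by (simp add: det_matrix_wirtinger)
  moreover have "?T \<in> sets lebesgue"
    using openT by (simp add: borel_open)
  ultimately have *: "?h ` ?T \<in> lmeasurable \<and> measure lebesgue (?h ` ?T) = (LINT z:S|lborel. ?J z)"
    using has_measure_differentiable_image[OF _ derh injh] LINT by simp
  have "emeasure lborel (g ` S) = emeasure lborel (?h ` ?T)"
    using gS unfolding image by (intro emeasure_lborel_complex) auto
  also have "\<dots> = emeasure lebesgue (?h ` ?T)"
    using openhT by simp
  also have "\<dots> = ennreal (LINT z:S|lborel. ?J z)"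
    using * by (metis emeasure_eq_ennreal_measure fmeasurableD2 )
  finally show ?thesis .
qed

lemma emeasure_image_holomorphic:
  assumes S: "open S" and hol: "g holomorphic_on S" and inj: "inj_on g S"
    and int: "set_integrable lborel S (\<lambda>z. (norm (deriv g z))\<^sup>2)"
  shows "emeasure lborel (g ` S) = ennreal (LINT z:S|lborel. (norm (deriv g z))\<^sup>2)"
proof -
  have "(g has_derivative (\<lambda>u. deriv g z * u + 0 * cnj u)) (at z)" if "z \<in> S" for z
    using holomorphic_derivI[OF hol S that] by (simp add: has_field_derivative_def)
  moreover have "open (g ` S)"
    using open_mapping_thm3[OF hol S inj] .
  ultimately show ?thesis
    using emeasure_image_wirtinger[OF S _ inj, of "deriv g" "\<lambda>_. 0"] int by simp
qed

text \<open>Lebesgue measure is determined by its values on boxes, and the preimage of a box under a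
  rotation is the image of that box under the inverse rotation, a holomorphic map whose derivative
  has modulus one.\<close>
lemma lborel_distr_rotation:
  fixes w :: complex
  assumes w: "norm w = 1"
  shows "distr lborel borel ((*) w) = lborel"
proof (rule lborel_eqI[symmetric])
  fix l u :: complex assume le: "\<And>b. b \<in> Basis \<Longrightarrow> l \<bullet> b \<le> u \<bullet> b"
  have w0: "w \<noteq> 0" using w by auto
  have ww: "w * cnj w = 1" using w by (simp add: complex_norm_square[symmetric])
  have vimage: "(*) w -` box l u = (*) (cnj w) ` box l u"
  proof (intro Set.set_eqI iffI)
    fix z assume "z \<in> (*) w -` box l u"
    then have "w * z \<in> box l u" by simp
    moreover have "z = cnj w * (w * z)" using ww by (simp add: algebra_simps)
    ultimately show "z \<in> (*) (cnj w) ` box l u" by blast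
  next
    fix z assume "z \<in> (*) (cnj w) ` box l u"
    then obtain y where "y \<in> box l u" and z: "z = cnj w * y" by blast
    moreover have "w * z = y" using ww z by (metis mult.assoc mult_1)
    ultimately show "z \<in> (*) w -` box l u" by (metis vimageI2)
  qed
  have 1: "set_integrable lborel (box l u) (\<lambda>z. 1 :: real)"
    unfolding set_integrable_def by (simp add: emeasure_lborel_box_eq)
  have d: "deriv ((*) (cnj w)) z = cnj w" for z
    by (rule DERIV_imp_deriv) (auto intro!: derivative_eq_intros)
  have "emeasure (distr lborel borel ((*) w)) (box l u) = emeasure lborel ((*) (cnj w) ` box l u)"
    by (subst emeasure_distr) (auto simp: vimage)
  also have "\<dots> = ennreal (LINT z:box l u|lborel. (norm (deriv ((*) (cnj w)) z))\<^sup>2)"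
    by (rule emeasure_image_holomorphic) (use w0 1 w in \<open>auto intro!: holomorphic_intros inj_onI simp: d\<close>)
  also have "\<dots> = ennreal (measure lborel (box l u))"
    using w by (simp add: d set_lebesgue_integral_def)
  also have "\<dots> = (\<Prod>b\<in>Basis. (u - l) \<bullet> b)"
    using le by (simp add: measure_lborel_box)
  finally show "emeasure (distr lborel borel ((*) w)) (box l u) = (\<Prod>b\<in>Basis. (u - l) \<bullet> b)" .
qed simp

section \<open>Integrals over annuli\<close>

definition annulus :: "real \<Rightarrow> real \<Rightarrow> complex set" where
  "annulus a b = {z. a < norm z \<and> norm z < b}"

lemma open_annulus: "open (annulus a b)"
  unfolding annulus_def by (intro open_Collect_conj open_Collect_less continuous_intros)

lemma emeasure_annulus:
  assumes "0 \<le> a" "a \<le> b"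
  shows "emeasure lborel (annulus a b) = ennreal (pi * (b\<^sup>2 - a\<^sup>2))"
proof (cases "a = b")
  case True
  then have "annulus a b = {}" by (auto simp: annulus_def)
  then show ?thesis using True by simp
next
  case False
  have "annulus a b = ball 0 b - cball 0 a"
    by (auto simp: annulus_def dist_norm)
  moreover have "cball (0::complex) a \<subseteq> ball 0 b" using assms False by auto
  moreover have "emeasure lborel (ball (0::complex) b) = ennreal (pi * b\<^sup>2)"
    "emeasure lborel (cball (0::complex) a) = ennreal (pi * a\<^sup>2)"
    using assms by (simp_all add: emeasure_ball emeasure_cball unit_ball_vol_2)
  ultimately show ?thesis
    using assms by (simp add: emeasure_Diff ennreal_minus right_diff_distrib)
qed

text \<open>Polar coordinates for radial functions: an annulus with radii \<open>s < b\<close> has area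
  \<open>\<pi> (b\<^sup>2 - s\<^sup>2)\<close>, so on a given annulus the square of the modulus is uniformly distributed, with
  density \<open>\<pi>\<close>. Both measures are compared on half-lines.\<close>
lemma distr_norm_square_annulus:
  assumes "0 \<le> a" "a < b"
  shows "distr (density lborel (indicator (annulus a b))) borel (\<lambda>z. (norm z)\<^sup>2)
         = density lborel (\<lambda>t::real. ennreal pi * indicator {a\<^sup>2..b\<^sup>2} t)" (is "?M = ?N")
proof (rule measure_eqI_lessThan)
  have eq: "emeasure ?M {x<..} = ennreal pi * ennreal (b\<^sup>2 - min (b\<^sup>2) (max (a\<^sup>2) x))" for x
  proof -
    \<comment> \<open>The inner radius is clamped so that all positions of \<open>x\<close> relative to \<open>a\<^sup>2\<close> and \<open>b\<^sup>2\<close> are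
        treated alike; for \<open>x \<ge> b\<^sup>2\<close> it equals \<open>b\<close> and the annulus is empty.\<close>
    have vim: "(\<lambda>z. (norm z)\<^sup>2) -` {x<..} \<inter> annulus a b
       = annulus (sqrt (min (b\<^sup>2) (max (a\<^sup>2) x))) b"
    proof -
      have "a < norm z \<and> norm z < b \<and> x < (norm z)\<^sup>2 \<longleftrightarrow>
            sqrt (min (b\<^sup>2) (max (a\<^sup>2) x)) < norm z \<and> norm z < b" for z :: complex
      proof -
        have sq: "u < v \<longleftrightarrow> u\<^sup>2 < v\<^sup>2" if "0 \<le> u" "0 \<le> v" for u v :: real
          using that by (meson power2_less_imp_less power_strict_mono pos2)
        have "sqrt (min (b\<^sup>2) (max (a\<^sup>2) x)) < norm z \<longleftrightarrow> min (b\<^sup>2) (max (a\<^sup>2) x) < (norm z)\<^sup>2"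
          by (metis norm_ge_zero real_sqrt_less_iff real_sqrt_unique)
        moreover have "a < norm z \<longleftrightarrow> a\<^sup>2 < (norm z)\<^sup>2"
          using assms by (intro sq) auto
        moreover have "norm z < b \<longleftrightarrow> (norm z)\<^sup>2 < b\<^sup>2"
          using assms by (intro sq) auto
        ultimately show ?thesis by auto
      qed
      thus ?thesis by (auto simp: annulus_def)
    qed
    have "emeasure ?M {x<..} = emeasure lborel ((\<lambda>z. (norm z)\<^sup>2) -` {x<..} \<inter> annulus a b)"
    proof -
      have "open ((\<lambda>z::complex. (norm z)\<^sup>2) -` {x<..})"
        by (intro open_vimage continuous_intros open_greaterThan)
      then show ?thesis
        using open_annulus[of a b]
        by (simp add: emeasure_distr emeasure_restricted Int_commute borel_open)
    qed
    also have "\<dots> = ennreal (pi * (b\<^sup>2 - min (b\<^sup>2) (max (a\<^sup>2) x)))"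
    proof -
      define m where "m = min (b\<^sup>2) (max (a\<^sup>2) x)"
      have "0 \<le> m" "m \<le> b\<^sup>2" by (auto simp: m_def le_max_iff_disj)
      then have "0 \<le> sqrt m" "sqrt m \<le> b" using assms by (auto intro: real_le_lsqrt)
      then show ?thesis
        unfolding vim m_def[symmetric] using \<open>0 \<le> m\<close> by (simp add: emeasure_annulus)
    qed
    finally show ?thesis by (simp add: ennreal_mult' )
  qed
  show "emeasure ?M {x<..} < \<infinity>" for x
    unfolding eq by (simp add: ennreal_mult_less_top)
  show "emeasure ?M {x<..} = emeasure ?N {x<..}" for x
  proof -
    have "emeasure ?N {x<..} = (\<integral>\<^sup>+t. ennreal pi * indicator ({a\<^sup>2..b\<^sup>2} \<inter> {x<..}) t \<partial>lborel)"
      by (subst emeasure_density) (auto simp: indicator_inter_arith mult.assoc)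
    also have "\<dots> = ennreal pi * emeasure lborel ({a\<^sup>2..b\<^sup>2} \<inter> {x<..})"
      by (simp add: nn_integral_cmult)
    also have "emeasure lborel ({a\<^sup>2..b\<^sup>2} \<inter> {x<..}) = ennreal (b\<^sup>2 - min (b\<^sup>2) (max (a\<^sup>2) x))"
    proof -
      have ab: "a\<^sup>2 < b\<^sup>2" using assms by (simp add: power_strict_mono)
      consider "x < a\<^sup>2" | "a\<^sup>2 \<le> x" "x \<le> b\<^sup>2" | "b\<^sup>2 < x" by linarith
      then show ?thesis
      proof cases
        case 1
        then have "{a\<^sup>2..b\<^sup>2} \<inter> {x<..} = {a\<^sup>2..b\<^sup>2}" by auto
        then show ?thesis using 1 ab by simp
      next
        case 2
        then have "{a\<^sup>2..b\<^sup>2} \<inter> {x<..} = {x<..b\<^sup>2}" by auto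
        then show ?thesis using 2 ab by simp
      next
        case 3
        then have *: "{a\<^sup>2..b\<^sup>2} \<inter> {x<..} = {}" by auto
        show ?thesis unfolding * using 3 ab by simp
      qed
    qed
    finally show ?thesis by (simp add: eq)
  qed
qed auto

lemma integral_radial_annulus:
  assumes ab: "0 \<le> a" "a < b"
    and F: "\<And>t. a\<^sup>2 \<le> t \<Longrightarrow> t \<le> b\<^sup>2 \<Longrightarrow> (F has_field_derivative \<phi> t) (at t)"
    and cont: "\<And>t. a\<^sup>2 \<le> t \<Longrightarrow> t \<le> b\<^sup>2 \<Longrightarrow> isCont \<phi> t"
  shows "(LINT z:annulus a b|lborel. \<phi> ((norm z)\<^sup>2)) = pi * (F (b\<^sup>2) - F (a\<^sup>2))"
proof -
  let ?\<psi> = "\<lambda>t. indicator {a\<^sup>2..b\<^sup>2} t *\<^sub>R \<phi> t"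
  have ab2: "a\<^sup>2 \<le> b\<^sup>2" using ab by (simp add: power_mono)
  have meas: "?\<psi> \<in> borel_measurable borel"
    by (rule borel_measurable_continuous_on_indicator) (use cont in \<open>auto intro!: continuous_at_imp_continuous_on\<close>)
  have [measurable]: "annulus a b \<in> sets borel" using open_annulus by auto
  have "(LINT z:annulus a b|lborel. \<phi> ((norm z)\<^sup>2))
        = (LINT z|lborel. indicator (annulus a b) z *\<^sub>R ?\<psi> ((norm z)\<^sup>2))"
    unfolding set_lebesgue_integral_def using ab
    by (intro Bochner_Integration.integral_cong) (auto simp: annulus_def indicator_def power_mono)
  also have "\<dots> = (LINT z|density lborel (\<lambda>z. ennreal (indicator (annulus a b) z)). ?\<psi> ((norm z)\<^sup>2))"
    using meas by (subst integral_density) auto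
  also have "\<dots> = (LINT t|distr (density lborel (indicator (annulus a b))) borel (\<lambda>z. (norm z)\<^sup>2). ?\<psi> t)"
    using meas by (subst integral_distr) (auto simp: ennreal_indicator)
  also have "\<dots> = (LINT t|density lborel (\<lambda>t. ennreal (pi * indicator {a\<^sup>2..b\<^sup>2} t)). ?\<psi> t)"
    unfolding distr_norm_square_annulus[OF ab] by (simp add: ennreal_mult' ennreal_indicator)
  also have "\<dots> = (LINT t|lborel. (pi * indicator {a\<^sup>2..b\<^sup>2} t) *\<^sub>R ?\<psi> t)"
    using meas by (subst integral_density) auto
  also have "\<dots> = (LINT t|lborel. pi * (\<phi> t * indicator {a\<^sup>2..b\<^sup>2} t))"
    by (intro Bochner_Integration.integral_cong) (auto simp: indicator_def)
  also have "\<dots> = pi * (LINT t|lborel. \<phi> t * indicator {a\<^sup>2..b\<^sup>2} t)"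
    by simp
  also have "(LINT t|lborel. \<phi> t * indicator {a\<^sup>2..b\<^sup>2} t) = F (b\<^sup>2) - F (a\<^sup>2)"
    using ab2 F cont
    by (intro integral_FTC_Icc_real) auto
  finally show ?thesis .
qed

lemma set_integrable_annulus:
  fixes f :: "complex \<Rightarrow> 'a :: {banach, second_countable_topology}"
  assumes "continuous_on (cball 0 b - ball 0 a) f"
  shows "set_integrable lborel (annulus a b) f"
proof -
  have "compact (cball 0 b - ball (0::complex) a)"
    by (intro compact_diff) auto
  hence "set_integrable lborel (cball 0 b - ball 0 a) f"
    unfolding set_integrable_def using assms by (rule borel_integrable_compact)
  thus ?thesis
    by (rule set_integrable_subset) (auto simp: annulus_def open_annulus[unfolded annulus_def])
qed

text \<open>The annulus is invariant under rotations. A rotation by \<open>w\<close> multiplies the integrand by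
  \<open>w powi (k - l)\<close>, and for \<open>k \<noteq> l\<close> the angle can be chosen so that this factor is \<open>-1\<close>.\<close>
lemma integral_powi_orthogonal:
  assumes "0 \<le> a" and kl: "k \<noteq> l"
  shows "(LINT z:annulus a b|lborel. z powi k * cnj (z powi l)) = 0"
proof -
  define w where "w = cis (pi / of_int (k - l))"
  define f where "f = (\<lambda>z::complex. indicator (annulus a b) z *\<^sub>R (z powi k * cnj (z powi l)))"
  have w: "norm w = 1" by (simp add: w_def)
  have w0: "w \<noteq> 0" using w by auto
  have "w powi k * cnj (w powi l) = w powi (k - l)"
  proof -
    have "cnj w = inverse w"
      by (simp add: w_def cis_cnj cis_inverse)
    then show ?thesis
      using w0 unfolding complex_cnj_power_int by (simp add: power_int_diff power_int_inverse divide_inverse)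
  qed
  also have "\<dots> = -1"
    using kl by (simp add: w_def cis_power_int)
  finally have ww: "w powi k * cnj (w powi l) = -1" .
  have meas: "f \<in> borel_measurable borel"
    unfolding f_def using assms open_annulus
    by (intro borel_measurable_continuous_on_indicator) (auto intro!: continuous_intros simp: annulus_def)
  have rot: "f (w * z) = - f z" for z
  proof -
    have "w * z \<in> annulus a b \<longleftrightarrow> z \<in> annulus a b"
      by (simp add: annulus_def norm_mult w)
    moreover have "(w * z) powi k * cnj ((w * z) powi l) = (w powi k * cnj (w powi l)) * (z powi k * cnj (z powi l))"
      by (simp add: power_int_mult_distrib)
    ultimately show ?thesis unfolding f_def ww by (simp add: indicator_def del: complex_cnj_power_int)
  qed
  have "(LINT z|lborel. f z) = (LINT z|distr lborel borel ((*) w). f z)"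
    by (simp only: lborel_distr_rotation[OF w])
  also have "\<dots> = (LINT z|lborel. f (w * z))"
    using meas by (subst integral_distr) auto
  also have "\<dots> = - (LINT z|lborel. f z)"
    by (simp add: rot)
  finally show ?thesis
    by (simp add: set_lebesgue_integral_def f_def)
qed

lemma integral_powi_square:
  assumes ab: "0 < a" "a < b" and k: "k \<noteq> -1"
  shows "(LINT z:annulus a b|lborel. (norm (z powi k))\<^sup>2)
         = pi * (b powi (2 * k + 2) - a powi (2 * k + 2)) / of_int (k + 1)"
proof -
  have k1: "of_int k + 1 \<noteq> (0::real)"
    using k by (metis add_eq_0_iff2 of_int_eq_iff of_int_minus of_int_1)
  have sq: "(x\<^sup>2) powi m = x powi (2 * m)" for x :: real and m
    by (simp add: power_int_mult)
  have "(LINT z:annulus a b|lborel. (norm (z powi k))\<^sup>2)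
      = (LINT z:annulus a b|lborel. ((norm z)\<^sup>2) powi k)"
    by (simp add: norm_power_int sq mult.commute[of 2] power_int_mult)
  also have "\<dots> = pi * ((b\<^sup>2) powi (k + 1) / of_int (k + 1) - (a\<^sup>2) powi (k + 1) / of_int (k + 1))"
  proof (rule integral_radial_annulus)
    fix t assume "a\<^sup>2 \<le> t" "t \<le> b\<^sup>2"
    then have "t \<noteq> 0" using ab by (smt (verit) zero_less_power)
    then have "((\<lambda>t. t powi (k + 1)) has_field_derivative of_int (k + 1) * t powi k) (at t)"
      using DERIV_power_int[OF DERIV_ident, of "k + 1" t] by simp
    from DERIV_cdivide[OF this, of "of_int (k + 1)"]
    show "((\<lambda>t. t powi (k + 1) / of_int (k + 1)) has_field_derivative t powi k) (at t)"
      using k1 by simp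
    show "isCont (\<lambda>t. t powi k) t"
      using \<open>t \<noteq> 0\<close> by (intro continuous_intros) auto
  qed (use ab in auto)
  finally show ?thesis
    by (simp add: sq diff_divide_distrib algebra_simps)
qed

text \<open>Pythagoras for the orthogonal system of the powers of \<open>z\<close>. The exponent \<open>-1\<close> is excluded
  since its square norm is logarithmic; it does not occur in the derivative of a Laurent series.\<close>
lemma integral_laurent_polynomial_square:
  fixes c :: "int \<Rightarrow> complex"
  assumes ab: "0 < a" "a < b" and K: "finite K" "-1 \<notin> K"
  shows "(LINT z:annulus a b|lborel. (norm (\<Sum>k\<in>K. c k * z powi k))\<^sup>2)
         = (\<Sum>k\<in>K. (norm (c k))\<^sup>2 * (pi * (b powi (2 * k + 2) - a powi (2 * k + 2)) / of_int (k + 1)))"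
    (is "?L = ?R")
proof -
  let ?A = "annulus a b"
  have int: "set_integrable lborel ?A (\<lambda>z. c k * cnj (c l) * (z powi k * cnj (z powi l)))" for k l
    using ab by (intro set_integrable_annulus continuous_intros) auto
  have "complex_of_real ?L = (LINT z:?A|lborel. complex_of_real ((norm (\<Sum>k\<in>K. c k * z powi k))\<^sup>2))"
    by (rule set_integral_complex_of_real[symmetric])
  also have "\<dots> = (LINT z:?A|lborel. (\<Sum>k\<in>K. \<Sum>l\<in>K. c k * cnj (c l) * (z powi k * cnj (z powi l))))"
    by (simp only: complex_norm_square cnj_sum sum_product complex_cnj_mult mult_ac)
  also have "\<dots> = (\<Sum>k\<in>K. \<Sum>l\<in>K. (LINT z:?A|lborel. c k * cnj (c l) * (z powi k * cnj (z powi l))))"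
    using int unfolding set_lebesgue_integral_def set_integrable_def scaleR_sum_right
    by (simp add: Bochner_Integration.integral_sum)
  also have "\<dots> = (\<Sum>k\<in>K. \<Sum>l\<in>K. if l = k then c k * cnj (c k) * (LINT z:?A|lborel. z powi k * cnj (z powi k)) else 0)"
    using ab by (intro sum.cong refl) (auto simp: integral_powi_orthogonal simp del: complex_cnj_power_int)
  also have "\<dots> = (\<Sum>k\<in>K. c k * cnj (c k) * (LINT z:?A|lborel. z powi k * cnj (z powi k)))"
    using K by (simp add: sum.delta)
  also have "\<dots> = (\<Sum>k\<in>K. of_real ((norm (c k))\<^sup>2 * (LINT z:?A|lborel. (norm (z powi k))\<^sup>2)))"
    by (simp only: complex_norm_square[symmetric] set_integral_complex_of_real of_real_mult)
  also have "\<dots> = complex_of_real ?R"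
  proof -
    have "(LINT z:?A|lborel. (norm (z powi k))\<^sup>2) = pi * (b powi (2 * k + 2) - a powi (2 * k + 2)) / of_int (k + 1)"
      if "k \<in> K" for k
      using that K by (intro integral_powi_square ab) auto
    then show ?thesis by (simp only: of_real_sum cong: sum.cong)
  qed
  finally show ?thesis by (simp only: of_real_eq_iff)
qed

text \<open>The area (counted with multiplicity) of the image of an annulus under \<open>1 / z + h z\<close>, bounded
  from below by finitely many Laurent coefficients. The formula for Laurent polynomials gives the
  values \<open>Q N\<close> for the partial sums of the derivative; these increase with \<open>N\<close> and converge
  to the integral, by dominated convergence.\<close>
lemma area_annulus_laurent_ge:
  assumes ab: "0 < a" "a < b" "b < 1" and h: "h holomorphic_on ball 0 1"
  shows "(LINT z:annulus a b|lborel. (norm (deriv h z - 1 / z\<^sup>2))\<^sup>2) \<ge>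
     pi * (1 / a\<^sup>2 - 1 / b\<^sup>2
       + (\<Sum>n<N. real (Suc n) * (norm ((deriv ^^ Suc n) h 0 / fact (Suc n)))\<^sup>2 * (b ^ (2 * Suc n) - a ^ (2 * Suc n))))"
proof -
  let ?A = "annulus a b"
  define \<beta> where "\<beta> n = (deriv ^^ n) h 0 / fact n" for n
  define d where "d n = of_nat (Suc n) * \<beta> (Suc n)" for n
  define p where "p N z = (\<Sum>n<N. d n * z ^ n) - 1 / z\<^sup>2" for N and z :: complex
  \<comment> \<open>\<open>B\<close> bounds all partial sums of the regular part on the annulus.\<close>
  define B where "B = (\<Sum>n. norm (d n) * b ^ n)"
  define Q where "Q N = pi * (1 / a\<^sup>2 - 1 / b\<^sup>2 + (\<Sum>n<N. real (Suc n) * (norm (\<beta> (Suc n)))\<^sup>2 * (b ^ (2 * Suc n) - a ^ (2 * Suc n))))" for N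
  have h': "deriv h holomorphic_on ball 0 1"
    using h by (intro holomorphic_deriv) auto
  have sums: "(\<lambda>n. d n * z ^ n) sums deriv h z" if "norm z < 1" for z
  proof -
    have "(deriv ^^ n) (deriv h) 0 / fact n = d n" for n
      by (simp add: d_def \<beta>_def funpow_Suc_right del: funpow.simps of_nat_Suc)
    then show ?thesis
      using holomorphic_power_series[OF h', of z] that by simp
  qed
  have summ: "summable (\<lambda>n. norm (d n) * b ^ n)"
  proof -
    define r where "r = (b + 1) / 2"
    have r: "b < r" "r < 1" "0 < r" using ab by (auto simp: r_def)
    have "summable (\<lambda>n. d n * (of_real r) ^ n)"
      using sums[of "of_real r"] r by (simp add: sums_iff)
    then have "summable (\<lambda>n. norm (d n * (of_real b) ^ n))"
      by (rule powser_insidea) (use r ab in auto)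
    then show ?thesis using ab by (simp add: norm_mult norm_power)
  qed
  have p_eq: "p N z = (\<Sum>k\<in>insert (-2) (int ` {..<N}). (if k = -2 then -1 else d (nat k)) * z powi k)" for N z
    by (subst sum.insert) (auto simp: p_def sum.reindex power_int_minus field_simps)
  have Q: "(LINT z:?A|lborel. (norm (p N z))\<^sup>2) = Q N" for N
    unfolding p_eq
  proof (subst integral_laurent_polynomial_square)
    have "(norm (d n))\<^sup>2 * (pi * (b powi (2 * int n + 2) - a powi (2 * int n + 2)) / of_int (int n + 1))
       = pi * (real (Suc n) * (norm (\<beta> (Suc n)))\<^sup>2 * (b ^ (2 * Suc n) - a ^ (2 * Suc n)))" for n
    proof -
      have pow: "x powi (2 * int n + 2) = x ^ (2 * Suc n)" for x :: real
        using power_int_of_nat[of x "2 * Suc n"] by (simp add: algebra_simps)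
      have norm_d: "norm (d n) = real (Suc n) * norm (\<beta> (Suc n))"
        by (simp add: d_def norm_mult del: of_nat_Suc)
      have of_int: "of_int (int n + 1) = real (Suc n)" by simp
      show ?thesis
        unfolding pow norm_d of_int by (simp add: power2_eq_square del: of_nat_Suc power_Suc mult_Suc_right)
    qed
    note summand = this
    have "(\<Sum>k\<in>int ` {..<N}. (norm (if k = -2 then -1 else d (nat k)))\<^sup>2 *
            (pi * (b powi (2 * k + 2) - a powi (2 * k + 2)) / of_int (k + 1)))
        = (\<Sum>n<N. (norm (d n))\<^sup>2 * (pi * (b powi (2 * int n + 2) - a powi (2 * int n + 2)) / of_int (int n + 1)))"
      by (subst sum.reindex) (auto intro!: sum.cong)
    also have "\<dots> = pi * (\<Sum>n<N. real (Suc n) * (norm (\<beta> (Suc n)))\<^sup>2 * (b ^ (2 * Suc n) - a ^ (2 * Suc n)))"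
      unfolding summand sum_distrib_left ..
    finally show "(\<Sum>k\<in>insert (-2) (int ` {..<N}). (norm (if k = -2 then -1 else d (nat k)))\<^sup>2 *
          (pi * (b powi (2 * k + 2) - a powi (2 * k + 2)) / of_int (k + 1))) = Q N"
      by (subst sum.insert) (auto simp: Q_def power_int_minus field_simps)
  qed (use ab in auto)
  have bound: "norm (p N z) \<le> B + 1 / a\<^sup>2" if "z \<in> ?A" for z N
  proof -
    have z: "a < norm z" "norm z < b" using that by (auto simp: annulus_def)
    have "norm (\<Sum>n<N. d n * z ^ n) \<le> (\<Sum>n<N. norm (d n) * b ^ n)"
      using z ab by (intro sum_norm_le) (auto simp: norm_mult norm_power intro!: mult_left_mono power_mono)
    also have "\<dots> \<le> B"
      unfolding B_def using ab by (intro sum_le_suminf summ) auto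
    finally have "norm (\<Sum>n<N. d n * z ^ n) \<le> B" .
    moreover have "norm (1 / z\<^sup>2) \<le> 1 / a\<^sup>2"
      using z ab by (auto simp: norm_divide norm_power intro!: divide_left_mono power_mono mult_pos_pos)
    ultimately show ?thesis
      unfolding p_def by (meson add_mono norm_triangle_ineq4 order_trans)
  qed
  have lim: "(\<lambda>N. LINT z:?A|lborel. (norm (p N z))\<^sup>2) \<longlonglongrightarrow> (LINT z:?A|lborel. (norm (deriv h z - 1 / z\<^sup>2))\<^sup>2)"
    unfolding set_lebesgue_integral_def
  proof (rule integral_dominated_convergence)
    have cont: "continuous_on ?A (\<lambda>z. (norm (deriv h z - 1 / z\<^sup>2))\<^sup>2)"
      using ab by (intro continuous_intros holomorphic_on_imp_continuous_on holomorphic_on_subset[OF h'])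
                  (auto simp: annulus_def)
    have contp: "continuous_on ?A (\<lambda>z. (norm (p N z))\<^sup>2)" for N
      unfolding p_def using ab by (intro continuous_intros) (auto simp: annulus_def)
    show "(\<lambda>z. indicator ?A z *\<^sub>R (norm (deriv h z - 1 / z\<^sup>2))\<^sup>2) \<in> borel_measurable lborel"
      using borel_measurable_continuous_on_indicator[OF _ cont] open_annulus by auto
    show "(\<lambda>z. indicator ?A z *\<^sub>R (norm (p N z))\<^sup>2) \<in> borel_measurable lborel" for N
      using borel_measurable_continuous_on_indicator[OF _ contp] open_annulus by auto
    show "integrable lborel (\<lambda>z. indicator ?A z *\<^sub>R (B + 1 / a\<^sup>2)\<^sup>2)"
      using set_integrable_annulus[of b a "\<lambda>_. (B + 1 / a\<^sup>2)\<^sup>2"] by (simp add: set_integrable_def)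
    show "AE z in lborel. (\<lambda>N. indicator ?A z *\<^sub>R (norm (p N z))\<^sup>2)
             \<longlonglongrightarrow> indicator ?A z *\<^sub>R (norm (deriv h z - 1 / z\<^sup>2))\<^sup>2"
    proof (intro AE_I2)
      fix z :: complex
      show "(\<lambda>N. indicator ?A z *\<^sub>R (norm (p N z))\<^sup>2)
             \<longlonglongrightarrow> indicator ?A z *\<^sub>R (norm (deriv h z - 1 / z\<^sup>2))\<^sup>2"
      proof (cases "z \<in> ?A")
        case True
        then have "(\<lambda>N. \<Sum>n<N. d n * z ^ n) \<longlonglongrightarrow> deriv h z"
          using sums[of z] ab by (auto simp: annulus_def sums_def)
        then show ?thesis unfolding p_def by (intro tendsto_intros)
      qed auto
    qed
    show "AE z in lborel. norm (indicator ?A z *\<^sub>R (norm (p N z))\<^sup>2) \<le> indicator ?A z *\<^sub>R (B + 1 / a\<^sup>2)\<^sup>2" for N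
      using bound by (auto intro!: AE_I2 power_mono simp: indicator_def)
  qed
  have "Q N \<le> (LINT z:?A|lborel. (norm (deriv h z - 1 / z\<^sup>2))\<^sup>2)"
  proof (rule LIMSEQ_le_const[OF lim])
    have "Q N \<le> Q M" if "N \<le> M" for M
    proof -
      have "a ^ (2 * Suc n) \<le> b ^ (2 * Suc n)" for n
        using ab by (intro power_mono) auto
      then show ?thesis
        unfolding Q_def using that
        by (intro mult_left_mono add_left_mono sum_mono2 mult_nonneg_nonneg) auto
    qed
    then show "\<exists>M0. \<forall>M\<ge>M0. Q N \<le> (LINT z:?A|lborel. (norm (p M z))\<^sup>2)"
      unfolding Q by blast
  qed
  then show ?thesis by (simp only: Q_def \<beta>_def)
qed

section \<open>The area theorem\<close>

lemma near_identity_real_linear: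
  fixes \<beta> :: complex
  assumes "norm \<beta> \<le> 1 / 2"
  defines "M \<equiv> (\<lambda>u. u + \<beta> * cnj u)"
  shows "linear M" "norm u / 2 \<le> norm (M u)" "inj M" "surj M"
proof -
  show lin: "linear M"
    by (intro linearI) (simp_all add: M_def algebra_simps scaleR_conv_of_real)
  show lower: "norm u / 2 \<le> norm (M u)" for u
  proof -
    have "norm u - norm (\<beta> * cnj u) \<le> norm (M u)"
      unfolding M_def by (metis norm_diff_ineq)
    moreover have "norm (\<beta> * cnj u) \<le> 1 / 2 * norm u"
      unfolding norm_mult complex_mod_cnj using assms(1) by (intro mult_right_mono) auto
    ultimately show ?thesis by linarith
  qed
  have "u = 0" if "M u = 0" for u
    using lower[of u] that by simp
  then show "inj M"
    using lin by (subst linear_injective_0) auto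
  then show "surj M"
    using linear_inj_imp_surj[OF lin] by simp
qed

text \<open>On the circle \<open>\<bar>z\<bar> = e\<close> one has \<open>z = e\<^sup>2 cnj (1 / z)\<close>, so there \<open>1 / z + b1 z\<close> is the real-linear
  image \<open>M (1 / z)\<close> of a point of the circle with radius \<open>1 / e\<close>. As \<open>h\<close> agrees with
  \<open>h 0 + b1 z\<close> to second order and \<open>M\<close> shrinks lengths at most by half, the curve
  \<open>(1 / z + h z)\<close> with \<open>\<bar>z\<bar> = e\<close> stays in a slightly larger ellipse. The exterior \<open>W\<close> of that
  ellipse is connected, and it meets the image \<open>V\<close> of the punctured disc (near the pole) but not
  the frontier of \<open>V\<close>, which lies on the curve. Hence \<open>W\<close> is contained in \<open>V\<close>.

  A disc in place of the ellipse would be too crude: it exceeds the area enclosed by the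
  curve by an amount close to \<open>2 \<pi> \<bar>b1\<bar>\<close>, however small \<open>e\<close> is.\<close>
lemma outside_ellipse_subset_image:
  fixes b1 :: complex
  assumes e: "0 < e" "e < 1" and q: "norm b1 * e\<^sup>2 \<le> 1/2"
    and h: "h holomorphic_on ball 0 1"
    and inj: "inj_on (\<lambda>z. 1 / z + h z) (ball 0 1 - {0})"
    and close: "\<And>z. norm z = e \<Longrightarrow> norm (h z - h 0 - b1 * z) \<le> C * e\<^sup>2"
    and R: "R > 1 / e + 2 * C * e\<^sup>2"
    and w: "w \<notin> (\<lambda>u. h 0 + u + b1 * e\<^sup>2 * cnj u) ` ball 0 R"
  shows "w \<in> (\<lambda>z. 1 / z + h z) ` (ball 0 e - {0})"
proof -
  define g where "g = (\<lambda>z. 1 / z + h z)"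
  define M where "M = (\<lambda>u. u + b1 * e\<^sup>2 * cnj u)"
  define W where "W = - ((\<lambda>u. h 0 + M u) ` ball 0 R)"
  define V where "V = g ` (ball 0 e - {0})"
  have "norm (b1 * e\<^sup>2) \<le> 1 / 2"
    using q by (simp add: norm_mult norm_power)
  note M = near_identity_real_linear[OF this]
  have linM: "linear M" and surjM: "surj M"
    unfolding M_def by (rule M)+
  have lower: "norm u / 2 \<le> norm (M u)" for u
    unfolding M_def by (rule M)
  have blM: "bounded_linear M" using linM by (simp add: linear_conv_bounded_linear)
  have holg: "g holomorphic_on ball 0 1 - {0}"
    unfolding g_def by (intro holomorphic_intros holomorphic_on_subset[OF h]) auto
  have holge: "g holomorphic_on ball 0 e - {0}"
    by (rule holomorphic_on_subset[OF holg]) (use e in auto)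
  have openV: "open V"
    unfolding V_def using inj e unfolding g_def[symmetric]
    by (intro open_mapping_thm3[OF holge]) (auto intro: inj_on_subset)
  have sphere: "g z \<notin> W" if z: "norm z = e" for z
  proof -
    have z0: "z \<noteq> 0" using z e by auto
    obtain u where u: "M u = h z - h 0 - b1 * z" using surjM by (metis surj_def)
    have "norm u \<le> 2 * C * e\<^sup>2"
      using lower[of u] close[OF z] unfolding u by linarith
    moreover have "norm (1 / z) = 1 / e" using z by (simp add: norm_divide)
    ultimately have "norm (1 / z + u) < R"
      using R norm_triangle_ineq[of "1 / z" u] by linarith
    moreover have "h 0 + M (1 / z + u) = g z"
    proof -
      have "e\<^sup>2 * cnj (1 / z) = z"
      proof -
        have "complex_of_real (e\<^sup>2) = z * cnj z"
          using z complex_norm_square[of z] by simp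
        then show ?thesis using z0 by (simp add: field_simps)
      qed
      then have "M (1 / z) = 1 / z + b1 * z"
        by (simp add: M_def mult.assoc)
      then show ?thesis
        using linear_add[OF linM, of "1 / z" u] u by (simp add: g_def)
    qed
    ultimately show ?thesis
      unfolding W_def by (metis (no_types, lifting) ComplD imageI mem_ball_0)
  qed
  have bounded: "bounded ((\<lambda>u. h 0 + M u) ` ball 0 R)"
    using bounded_translation[OF bounded_linear_image[OF bounded_ball blM, of 0 R], of "h 0"]
    by (simp add: image_image)
  then obtain B where B: "\<And>u. u \<in> ball 0 R \<Longrightarrow> norm (h 0 + M u) \<le> B"
    unfolding bounded_iff by blast
  have "connected W"
  proof -
    have "convex ((\<lambda>u. h 0 + M u) ` ball 0 R)"
      using convex_translation[OF convex_linear_image[OF linM convex_ball, of 0 R], of "h 0"]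
      by (simp add: image_image)
    then show ?thesis
      unfolding W_def by (intro connected_complement_bounded_convex bounded) auto
  qed
  have pole: "filterlim g at_infinity (at 0)"
  proof -
    have "(h \<longlongrightarrow> h 0) (at 0)"
      using holomorphic_on_imp_continuous_on[OF h] continuous_on_eq_continuous_at[of "ball 0 1" h]
      by (intro isContD) simp
    moreover have "filterlim (\<lambda>z::complex. 1 / z) at_infinity (at 0)"
      using filterlim_inverse_at_infinity by (simp add: divide_inverse)
    ultimately show ?thesis unfolding g_def
      by (intro tendsto_add_filterlim_at_infinity')
  qed
  have big: "\<exists>d>0. \<forall>z. z \<noteq> 0 \<and> norm z < d \<longrightarrow> norm (g z) > K" for K
  proof -
    have "\<forall>\<^sub>F z in at 0. norm (g z) > K"
      using pole by (metis (mono_tags, lifting) eventually_mono filterlim_at_infinity_imp_norm_at_top filterlim_at_top_dense)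
    then show ?thesis by (auto simp: eventually_at dist_norm)
  qed
  have meet: "W \<inter> V \<noteq> {}"
  proof -
    obtain d where d: "d > 0" "\<And>z. z \<noteq> 0 \<Longrightarrow> norm z < d \<Longrightarrow> norm (g z) > B"
      using big by metis
    define z where "z = complex_of_real (min d e / 2)"
    have z: "z \<noteq> 0" "norm z < d" "norm z < e" using d(1) e by (auto simp: z_def)
    then have "norm (g z) > B" using d by auto
    then have "g z \<in> W" unfolding W_def using B by force
    then show ?thesis using z by (auto simp: V_def)
  qed
  have front: "W \<inter> frontier V = {}"
  proof (rule ccontr)
    assume "W \<inter> frontier V \<noteq> {}"
    then obtain v where v: "v \<in> W" "v \<in> closure V" "v \<notin> V"
      using openV by (auto simp: frontier_def interior_open)
    obtain d where d: "d > 0" "\<And>z. z \<noteq> 0 \<Longrightarrow> norm z < d \<Longrightarrow> norm (g z) > norm v + 1"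
      using big by metis
    \<comment> \<open>Near \<open>v\<close> the values of \<open>g\<close> come from points that stay away from the pole, that is, from
        a compact set; so \<open>v\<close> is itself a value.\<close>
    let ?K = "cball 0 e - ball (0::complex) d"
    have "compact (g ` ?K)"
      using e d(1)
      by (intro compact_continuous_image compact_diff holomorphic_on_imp_continuous_on
            holomorphic_on_subset[OF holg]) auto
    then have "closed (g ` ?K)" by (rule compact_imp_closed)
    moreover have "V \<inter> ball v 1 \<subseteq> g ` ?K"
    proof
      fix y assume y: "y \<in> V \<inter> ball v 1"
      then obtain z where z0: "y = g z" "z \<in> ball 0 e - {0}" unfolding V_def by blast
      then have z: "y = g z" "z \<noteq> 0" "norm z < e" by simp_all
      have "norm y < norm v + 1"
        using y norm_triangle_ineq2[of y v] by (auto simp: dist_norm norm_minus_commute)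
      then have "\<not> norm z < d" using d(2)[of z] z by auto
      then show "y \<in> g ` ?K" using z by auto
    qed
    moreover have "v \<in> closure (V \<inter> ball v 1)"
      using v(2) open_Int_closure_subset[of "ball v 1" V] by (auto simp: Int_commute)
    ultimately have "v \<in> g ` ?K"
      by (meson closure_minimal in_mono)
    then obtain z where z: "v = g z" "norm z \<le> e" "d \<le> norm z" by auto
    then have "z \<noteq> 0" using d(1) by auto
    then have "norm z = e" using z v(3) by (auto simp: V_def)
    then show False using sphere v(1) z(1) by auto
  qed
  have "W \<subseteq> V"
    using connected_Int_frontier[OF \<open>connected W\<close> meet] front by blast
  moreover have "w \<in> W" using w by (simp add: W_def M_def add.assoc)
  ultimately have "w \<in> V" by blast
  then show ?thesis by (simp only: V_def g_def)
qed

text \<open>The area is \<open>\<pi> R\<^sup>2 (1 - \<bar>\<beta>\<bar>\<^sup>2)\<close>; the bound that neglects the second factor is what the area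
  theorem needs, since there \<open>\<beta>\<close> tends to zero.\<close>
lemma emeasure_ellipse_le:
  fixes \<beta> c :: complex
  assumes \<beta>: "norm \<beta> \<le> 1 / 2" and R: "0 \<le> R"
  shows "open ((\<lambda>u. c + u + \<beta> * cnj u) ` ball 0 R)"
    and "emeasure lborel ((\<lambda>u. c + u + \<beta> * cnj u) ` ball 0 R) \<le> ennreal (pi * R\<^sup>2)"
proof -
  let ?M = "\<lambda>u. u + \<beta> * cnj u"
  let ?T = "\<lambda>u. c + u + \<beta> * cnj u"
  let ?J = "\<lambda>z::complex. \<bar>(norm (1::complex))\<^sup>2 - (norm \<beta>)\<^sup>2\<bar>"
  note M = near_identity_real_linear[OF \<beta>]
  have "open (?M ` ball 0 R)"
    using M(1,4) by (intro open_surjective_linear_image) auto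
  then have "open ((+) c ` ?M ` ball 0 R)"
    by (rule open_translation)
  then show op: "open (?T ` ball 0 R)"
    by (simp add: image_image add.assoc)
  have inj: "inj_on ?T (ball 0 R)"
  proof (rule inj_onI)
    fix u v assume "?T u = ?T v"
    then have "?M u = ?M v" by (simp add: add.assoc)
    then show "u = v" by (rule injD[OF M(3)])
  qed
  have der: "(?T has_derivative (\<lambda>u. 1 * u + \<beta> * cnj u)) (at z)" for z
    by (auto intro!: derivative_eq_intros)
  have int: "set_integrable lborel (ball 0 R) ?J"
    using R unfolding set_integrable_def by (simp add: emeasure_ball ennreal_mult_less_top)
  have "emeasure lborel (?T ` ball 0 R) = ennreal (LINT z:ball 0 R|lborel. ?J z)"
    by (rule emeasure_image_wirtinger[OF open_ball op inj der int])
  also have "(LINT z:ball 0 R|lborel. ?J z) = ?J 0 * (pi * R\<^sup>2)"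
    using R by (simp add: set_lebesgue_integral_def content_ball unit_ball_vol_2)
  also have "\<dots> \<le> 1 * (pi * R\<^sup>2)"
  proof (rule mult_right_mono)
    have "(norm \<beta>)\<^sup>2 \<le> 1" using \<beta> by (intro power_le_one) auto
    then show "?J 0 \<le> 1" by simp
  qed simp
  finally show "emeasure lborel (?T ` ball 0 R) \<le> ennreal (pi * R\<^sup>2)"
    by (simp add: ennreal_leI)
qed

lemma holomorphic_first_order_factor:
  assumes "h holomorphic_on ball 0 r" "0 < r"
  shows "\<exists>k. k holomorphic_on ball 0 r \<and> k 0 = deriv h 0 \<and> (\<forall>z. h z = h 0 + z * k z)"
proof (intro exI conjI allI)
  let ?k = "\<lambda>z. if z = 0 then deriv h 0 else (h z - h 0) / (z - 0)"
  show "?k holomorphic_on ball 0 r"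
    by (rule pole_lemma) (use assms in auto)
  show "?k 0 = deriv h 0" by simp
  show "h z = h 0 + z * ?k z" for z by simp
qed

text \<open>Gronwall's area theorem. By injectivity, the image of the annulus \<open>e < \<bar>z\<bar> < b\<close> is disjoint from
  that of the punctured disc of radius \<open>e\<close>, hence lies in an ellipse of area at most
  \<open>\<pi> (1 / e + O(e\<^sup>2))\<^sup>2\<close>. Compare this with the lower bound for the same area, which
  contains \<open>\<pi> / e\<^sup>2\<close> as well: the singular terms cancel up to \<open>O(e)\<close>, and letting first \<open>e\<close> tend
  to zero and then \<open>b\<close> to one gives the claim.\<close>
theorem area_theorem:
  assumes h: "h holomorphic_on ball 0 1"
    and inj: "inj_on (\<lambda>z. 1 / z + h z) (ball 0 1 - {0})"
  shows "(\<Sum>n<N. real (Suc n) * (norm ((deriv ^^ Suc n) h 0 / fact (Suc n)))\<^sup>2) \<le> 1"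
proof -
  define \<beta> where "\<beta> n = norm ((deriv ^^ Suc n) h 0 / fact (Suc n))" for n
  define b1 where "b1 = deriv h 0"
  let ?g = "\<lambda>z. 1 / z + h z"
  have holg: "?g holomorphic_on ball 0 1 - {0}"
    by (intro holomorphic_intros holomorphic_on_subset[OF h]) auto
  obtain C where C: "C \<ge> 0" "\<And>z. norm z \<le> 1 / 2 \<Longrightarrow> norm (h z - h 0 - b1 * z) \<le> C * (norm z)\<^sup>2"
  proof -
    obtain k where k: "k holomorphic_on ball 0 1" "k 0 = b1" "\<And>z. h z = h 0 + z * k z"
      using holomorphic_first_order_factor[OF h, simplified] unfolding b1_def by blast
    obtain l where l: "l holomorphic_on ball 0 1" "\<And>z. k z = k 0 + z * l z"
      using holomorphic_first_order_factor[OF k(1), simplified] by blast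
    have "bounded (l ` cball 0 (1/2))"
      by (intro compact_imp_bounded compact_continuous_image holomorphic_on_imp_continuous_on holomorphic_on_subset[OF l(1)]) auto
    then obtain C where C: "C > 0" "\<And>z. z \<in> cball 0 (1/2) \<Longrightarrow> norm (l z) \<le> C"
      unfolding bounded_pos by blast
    have "norm (h z - h 0 - b1 * z) \<le> C * (norm z)\<^sup>2" if "norm z \<le> 1 / 2" for z
    proof -
      have "h z - h 0 - b1 * z = l z * z\<^sup>2"
        using k(3)[of z] l(2)[of z] k(2) by (simp add: algebra_simps power2_eq_square)
      then show ?thesis using C(2)[of z] that by (simp add: norm_mult norm_power mult_right_mono)
    qed
    then show ?thesis using that[of C] C(1) by simp
  qed
  \<comment> \<open>The summand \<open>1\<close> makes the radius of the ellipse strictly larger than required.\<close>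
  define D where "D = 2 * C + 1"
  have area: "1 / e\<^sup>2 - 1 / b\<^sup>2 + (\<Sum>n<N. real (Suc n) * (\<beta> n)\<^sup>2 * (b ^ (2 * Suc n) - e ^ (2 * Suc n)))
        \<le> (1 / e + D * e\<^sup>2)\<^sup>2"
    if e: "0 < e" "e < 1 / 2" "norm b1 * e\<^sup>2 \<le> 1 / 2" and b: "e < b" "b < 1" for e b
  proof -
    define R where "R = 1 / e + D * e\<^sup>2"
    have R: "R > 1 / e + 2 * C * e\<^sup>2" "R \<ge> 0" using C(1) e by (auto simp: R_def D_def algebra_simps)
    let ?A = "annulus e b" and ?E = "(\<lambda>u. h 0 + u + b1 * e\<^sup>2 * cnj u) ` ball 0 R"
    have A_sub: "?A \<subseteq> ball 0 1 - {0}" using e b by (auto simp: annulus_def)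
    have "?g ` ?A \<subseteq> ?E"
    proof (rule ccontr)
      assume "\<not> ?g ` ?A \<subseteq> ?E"
      then obtain z where z: "z \<in> ?A" "?g z \<notin> ?E" by blast
      have "?g z \<in> ?g ` (ball 0 e - {0})"
      proof (rule outside_ellipse_subset_image[OF _ _ _ h inj _ R(1) z(2)])
        show "norm (h y - h 0 - b1 * y) \<le> C * e\<^sup>2" if "norm y = e" for y
          using C(2)[of y] that e by auto
      qed (use e in auto)
      then obtain y where y0: "?g z = ?g y" "y \<in> ball 0 e - {0}" by (rule imageE)
      then have y: "?g z = ?g y" "norm y < e" "y \<noteq> 0" by simp_all
      have "z = y"
      proof (rule inj_onD[OF inj y(1)])
        show "z \<in> ball 0 1 - {0}" using A_sub z(1) by (rule subsetD)
        show "y \<in> ball 0 1 - {0}" using y(2,3) e by simp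
      qed
      then show False using y(2) z(1) by (simp add: annulus_def)
    qed
    moreover have "norm (b1 * e\<^sup>2) \<le> 1 / 2" using e by (simp add: norm_mult norm_power)
    note ellipse = emeasure_ellipse_le[OF this R(2), of "h 0"]
    ultimately have "emeasure lborel (?g ` ?A) \<le> emeasure lborel ?E"
      by (intro emeasure_mono) (auto simp: borel_open)
    also have "\<dots> \<le> ennreal (pi * R\<^sup>2)" by (rule ellipse)
    finally have upper: "emeasure lborel (?g ` ?A) \<le> ennreal (pi * R\<^sup>2)" .
    have deriv: "deriv ?g z = deriv h z - 1 / z\<^sup>2" if "z \<in> ball 0 1 - {0}" for z
    proof (rule DERIV_imp_deriv)
      have "(h has_field_derivative deriv h z) (at z)"
        using that by (intro holomorphic_derivI[OF h]) auto
      then show "(?g has_field_derivative deriv h z - 1 / z\<^sup>2) (at z)"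
        using that by (auto intro!: derivative_eq_intros simp: power2_eq_square)
    qed
    have "set_integrable lborel ?A (\<lambda>z. (norm (deriv ?g z))\<^sup>2)"
      using e b
      by (intro set_integrable_annulus continuous_intros holomorphic_on_imp_continuous_on
            holomorphic_on_subset[OF holomorphic_deriv[OF holg]]) auto
    then have "emeasure lborel (?g ` ?A) = ennreal (LINT z:?A|lborel. (norm (deriv ?g z))\<^sup>2)"
      by (intro emeasure_image_holomorphic open_annulus holomorphic_on_subset[OF holg A_sub]
            inj_on_subset[OF inj A_sub])
    also have "(LINT z:?A|lborel. (norm (deriv ?g z))\<^sup>2)
             = (LINT z:?A|lborel. (norm (deriv h z - 1 / z\<^sup>2))\<^sup>2)"
    proof (rule set_lebesgue_integral_cong)
      show "\<forall>z. z \<in> ?A \<longrightarrow> (norm (deriv ?g z))\<^sup>2 = (norm (deriv h z - 1 / z\<^sup>2))\<^sup>2"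
        using deriv A_sub by (metis (no_types, lifting) subsetD)
    qed (simp add: borel_open open_annulus)
    finally have em: "emeasure lborel (?g ` ?A) = ennreal (LINT z:?A|lborel. (norm (deriv h z - 1 / z\<^sup>2))\<^sup>2)" .
    have "(LINT z:?A|lborel. (norm (deriv h z - 1 / z\<^sup>2))\<^sup>2) \<le> pi * R\<^sup>2"
      using upper unfolding em by (subst (asm) ennreal_le_iff) simp_all
    then show ?thesis
      using order_trans[OF area_annulus_laurent_ge[OF e(1) b h, of N]]
      unfolding \<beta>_def[symmetric] R_def[symmetric] by (meson mult_le_cancel_left_pos pi_gt_zero)
  qed
  have inner: "(\<Sum>n<N. real (Suc n) * (\<beta> n)\<^sup>2 * b ^ (2 * Suc n)) \<le> 1 / b\<^sup>2" if b: "0 < b" "b < 1" for b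
  proof (rule tendsto_le)
    let ?l = "\<lambda>e. \<Sum>n<N. real (Suc n) * (\<beta> n)\<^sup>2 * (b ^ (2 * Suc n) - e ^ (2 * Suc n))"
    have "(?l \<longlongrightarrow> (\<Sum>n<N. real (Suc n) * (\<beta> n)\<^sup>2 * (b ^ (2 * Suc n) - 0 ^ (2 * Suc n)))) (at_right 0)"
      by (intro tendsto_intros)
    then show "(?l \<longlongrightarrow> (\<Sum>n<N. real (Suc n) * (\<beta> n)\<^sup>2 * b ^ (2 * Suc n))) (at_right 0)"
      by simp
    have "((\<lambda>e. 1 / b\<^sup>2 + 2 * D * e + D\<^sup>2 * e ^ 4) \<longlongrightarrow> 1 / b\<^sup>2 + 2 * D * 0 + D\<^sup>2 * 0 ^ 4) (at_right 0)"
      by (intro tendsto_intros)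
    then show "((\<lambda>e. 1 / b\<^sup>2 + 2 * D * e + D\<^sup>2 * e ^ 4) \<longlongrightarrow> 1 / b\<^sup>2) (at_right 0)"
      by simp
    have "((\<lambda>e. norm b1 * e\<^sup>2) \<longlongrightarrow> norm b1 * 0\<^sup>2) (at_right 0)"
      by (intro tendsto_intros)
    then have "\<forall>\<^sub>F e in at_right 0. norm b1 * e\<^sup>2 < 1 / 2"
      by (rule order_tendstoD) simp
    moreover have "\<forall>\<^sub>F e in at_right 0. e \<in> {0<..<min (1/2) b}"
      using b by (intro eventually_at_right_real) auto
    ultimately show "\<forall>\<^sub>F e in at_right 0. ?l e \<le> 1 / b\<^sup>2 + 2 * D * e + D\<^sup>2 * e ^ 4"
    proof eventually_elim
      case (elim e)
      have "(1 / e + D * e\<^sup>2)\<^sup>2 = 1 / e\<^sup>2 + 2 * D * e + D\<^sup>2 * e ^ 4"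
        using elim by (simp add: power2_eq_square field_simps power4_eq_xxxx)
      with area[of e b] elim b show ?case by auto
    qed
  qed simp
  have "(\<Sum>n<N. real (Suc n) * (\<beta> n)\<^sup>2) \<le> 1"
  proof (rule tendsto_le)
    let ?l = "\<lambda>b. \<Sum>n<N. real (Suc n) * (\<beta> n)\<^sup>2 * b ^ (2 * Suc n)"
    have "(?l \<longlongrightarrow> (\<Sum>n<N. real (Suc n) * (\<beta> n)\<^sup>2 * 1 ^ (2 * Suc n))) (at_left 1)"
      by (intro tendsto_intros)
    then show "(?l \<longlongrightarrow> (\<Sum>n<N. real (Suc n) * (\<beta> n)\<^sup>2)) (at_left 1)" by simp
    have "((\<lambda>b. 1 / b\<^sup>2) \<longlongrightarrow> 1 / 1\<^sup>2) (at_left (1::real))"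
      by (intro tendsto_intros) auto
    then show "((\<lambda>b. 1 / b\<^sup>2) \<longlongrightarrow> 1) (at_left (1::real))" by simp
    have "\<forall>\<^sub>F b in at_left 1. b \<in> {0<..<1::real}"
      by (rule eventually_at_left_real) simp
    then show "\<forall>\<^sub>F b in at_left 1. ?l b \<le> 1 / b\<^sup>2"
      by eventually_elim (use inner in auto)
  qed simp
  then show ?thesis by (simp only: \<beta>_def)
qed

section \<open>Coefficients of univalent functions\<close>

text \<open>The reciprocal of \<open>f\<close> is again injective and has the form \<open>1 / z + h z\<close>: since \<open>f\<close> has its
  only zero at the origin, \<open>f z / z\<close> has no zeros in the disc. The last equation is the identity
  \<open>1 / f z = 1 / z + h z\<close> cleared of denominators, so that it can be read as an identity of power
  series.\<close>
lemma univalent_reciprocal: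
  assumes f: "f holomorphic_on ball 0 1" and f0: "f 0 = 0" and f'0: "deriv f 0 = 1"
    and inj: "inj_on f (ball 0 1)"
  obtains h where "h holomorphic_on ball 0 1" "inj_on (\<lambda>z. 1 / z + h z) (ball 0 1 - {0})"
    "\<And>z. norm z < 1 \<Longrightarrow> z - f z = z * (f z * h z)"
proof -
  obtain \<phi> where \<phi>: "\<phi> holomorphic_on ball 0 1" "\<phi> 0 = 1" "\<And>z. f z = z * \<phi> z"
    using holomorphic_first_order_factor[OF f] f0 f'0 by auto
  have nz: "\<phi> z \<noteq> 0" if "norm z < 1" for z
  proof (cases "z = 0")
    case False
    then have "f z \<noteq> f 0" using inj_onD[OF inj, of z 0] that by auto
    then show ?thesis using \<phi>(3) f0 by auto
  qed (simp add: \<phi>)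
  have "(\<lambda>z. 1 / \<phi> z) holomorphic_on ball 0 1"
    using nz by (intro holomorphic_intros \<phi>) auto
  then obtain h where h: "h holomorphic_on ball 0 1" "\<And>z. 1 / \<phi> z = 1 + z * h z"
    using holomorphic_first_order_factor[of "\<lambda>z. 1 / \<phi> z" 1] \<phi>(2) by auto
  have eq: "1 / z + h z = 1 / f z" if "z \<noteq> 0" for z
  proof -
    have "1 / f z = (1 / \<phi> z) / z" using \<phi>(3)[of z] by simp
    also have "\<dots> = (1 + z * h z) / z" unfolding h(2) ..
    finally have "1 / f z = (1 + z * h z) / z" .
    then show ?thesis using that by (simp add: field_simps)
  qed
  have "inj_on (\<lambda>z. 1 / z + h z) (ball 0 1 - {0})"
  proof (rule inj_onI)
    fix u v :: complex assume u: "u \<in> ball 0 1 - {0}" and v: "v \<in> ball 0 1 - {0}"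
      and "1 / u + h u = 1 / v + h v"
    then have "f u = f v" using eq by simp
    then show "u = v" by (rule inj_onD[OF inj]) (use u v in auto)
  qed
  moreover have "z - f z = z * (f z * h z)" if "norm z < 1" for z
  proof -
    have "\<phi> z * (1 + z * h z) = 1" using nz[OF that] h(2)[of z] by (simp add: field_simps)
    then have "z * (\<phi> z * (1 + z * h z)) = z" by simp
    then show ?thesis unfolding \<phi>(3)[of z] by (simp add: algebra_simps)
  qed
  ultimately show ?thesis using that h(1) by blast
qed

text \<open>When \<open>a\<^sub>2 = 0\<close>, comparing coefficients in \<open>z - f z = z f(z) h(z)\<close> shows that
  \<open>1 / f = 1 / z - a\<^sub>3 z - a\<^sub>4 z\<^sup>2 - (a\<^sub>5 - a\<^sub>3\<^sup>2) z\<^sup>3 + \<dots>\<close>, and the bound is the area theorem with the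
  remaining terms dropped.\<close>
lemma class_S_coefficient_bound:
  assumes f: "f \<in> class_S" and a2: "taylor_coeff f 2 = 0"
  shows "(norm (taylor_coeff f 3))\<^sup>2 + 2 * (norm (taylor_coeff f 4))\<^sup>2
         + 3 * (norm (taylor_coeff f 5 - (taylor_coeff f 3)\<^sup>2))\<^sup>2 \<le> 1"
proof -
  have f': "f holomorphic_on ball 0 1" "f 0 = 0" "deriv f 0 = 1" "inj_on f (ball 0 1)"
    using f by (auto simp: class_S_def class_A_def)
  obtain h where h: "h holomorphic_on ball 0 1" "inj_on (\<lambda>z. 1 / z + h z) (ball 0 1 - {0})"
    "\<And>z. norm z < 1 \<Longrightarrow> z - f z = z * (f z * h z)"
    using univalent_reciprocal[OF f'] by blast
  define F where "F = fps_expansion f 0"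
  define H where "H = fps_expansion h 0"
  have F_nth: "fps_nth F n = taylor_coeff f n" for n
    by (simp add: F_def fps_expansion_def taylor_coeff_def)
  have H_nth: "fps_nth H n = taylor_coeff h n" for n
    by (simp add: H_def fps_expansion_def taylor_coeff_def)
  have F: "f has_fps_expansion F" and H: "h has_fps_expansion H"
    using f'(1) h(1) unfolding F_def H_def
    by (auto intro!: analytic_at_imp_has_fps_expansion_0 holomorphic_on_imp_analytic_at[OF _ open_ball])
  have "(\<lambda>z. z - f z) has_fps_expansion fps_X - F"
    by (intro fps_expansion_intros F)
  moreover have "(\<lambda>z. z * (f z * h z)) has_fps_expansion fps_X * (F * H)"
    by (intro fps_expansion_intros F H)
  moreover have "\<forall>\<^sub>F z in nhds 0. z - f z = z * (f z * h z)"
  proof -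
    have "\<forall>\<^sub>F z in nhds 0. z \<in> ball (0::complex) 1"
      by (intro eventually_nhds_in_open) auto
    then show ?thesis by eventually_elim (use h(3) in auto)
  qed
  ultimately have "(\<lambda>z. z * (f z * h z)) has_fps_expansion fps_X - F"
    and "(\<lambda>z. z * (f z * h z)) has_fps_expansion fps_X * (F * H)"
    using has_fps_expansion_cong[of "\<lambda>z. z - f z" "\<lambda>z. z * (f z * h z)" "fps_X - F" "fps_X - F"]
    by auto
  then have FH: "fps_X - F = fps_X * (F * H)"
    by (rule fps_expansion_unique_complex)
  have F0: "fps_nth F 0 = 0" and F1: "fps_nth F (Suc 0) = 1" and F2: "fps_nth F (Suc (Suc 0)) = 0"
    using f' a2 by (simp_all add: F_nth taylor_coeff_def numeral_2_eq_2)
  have nth: "fps_nth (fps_X - F) (Suc n) = fps_nth (F * H) n" for n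
    unfolding FH by simp
  note coeffs = fps_mult_nth F0 F1 F2 numeral_eq_Suc sum.atLeast0_atMost_Suc
  have H0: "fps_nth H 0 = 0"
    using nth[of 1] by (simp add: coeffs)
  have H1: "fps_nth H 1 = - fps_nth F 3"
    using nth[of 2] by (simp add: coeffs)
  have H2: "fps_nth H 2 = - fps_nth F 4"
    using nth[of 3] H0 by (simp add: coeffs)
  have H3: "fps_nth H 3 = - (fps_nth F 5 - (fps_nth F 3)\<^sup>2)"
    using nth[of 4] H0 H1 by (simp add: coeffs algebra_simps)
  have "(\<Sum>n<3. real (Suc n) * (norm (taylor_coeff h (Suc n)))\<^sup>2) \<le> 1"
    using area_theorem[OF h(1,2), of 3] by (simp only: taylor_coeff_def)
  then have "(norm (fps_nth H 1))\<^sup>2 + 2 * (norm (fps_nth H 2))\<^sup>2 + 3 * (norm (fps_nth H 3))\<^sup>2 \<le> 1"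
    unfolding H_nth by (simp add: eval_nat_numeral)
  then show ?thesis
    unfolding H1 H2 H3 norm_minus_cancel F_nth .
qed

section \<open>Toeplitz determinants of order three\<close>

lemma det_dim_2:
  fixes A :: "'a :: comm_ring_1 mat"
  assumes A: "A \<in> carrier_mat 2 2"
  shows "Determinant.det A = A $$ (0, 0) * A $$ (1, 1) - A $$ (0, 1) * A $$ (1, 0)"
proof -
  have "Determinant.det (mat_delete A 0 j) = mat_delete A 0 j $$ (0, 0)" for j
    using A mat_delete_carrier[of A 2 2] by (intro det_single) auto
  then show ?thesis
    using A by (subst laplace_expansion_row[OF A, of 0])
      (auto simp: cofactor_def mat_delete_def numeral_2_eq_2)
qed

lemma det_dim_3:
  fixes A :: "'a :: comm_ring_1 mat"
  assumes A: "A \<in> carrier_mat 3 3"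
  shows "Determinant.det A =
      A $$ (0, 0) * (A $$ (1, 1) * A $$ (2, 2) - A $$ (1, 2) * A $$ (2, 1))
    - A $$ (0, 1) * (A $$ (1, 0) * A $$ (2, 2) - A $$ (1, 2) * A $$ (2, 0))
    + A $$ (0, 2) * (A $$ (1, 0) * A $$ (2, 1) - A $$ (1, 1) * A $$ (2, 0))"
proof -
  have "mat_delete A 0 j \<in> carrier_mat 2 2" for j
    using A mat_delete_carrier[of A 3 3] by auto
  note d = det_dim_2[OF this]
  show ?thesis
    using A unfolding laplace_expansion_row[OF A, of 0, simplified] cofactor_def d
    by (auto simp: mat_delete_def eval_nat_numeral algebra_simps)
qed

lemma toeplitz_det_3:
  "toeplitz_det 3 n f =
    (taylor_coeff f n - taylor_coeff f (n + 2)) *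
    ((taylor_coeff f n)\<^sup>2 - 2 * (taylor_coeff f (n + 1))\<^sup>2 + taylor_coeff f n * taylor_coeff f (n + 2))"
  unfolding toeplitz_det_def
  by (subst det_dim_3) (simp_all add: toeplitz_mat_def power2_eq_square algebra_simps)

theorem theorem4:
  "(\<forall>f\<in>class_S. taylor_coeff f 2 = 0 \<longrightarrow> norm (toeplitz_det 3 2 f) \<le> 4 / 3) \<and>
   (\<exists>C::real. 7.3883 \<le> C \<and> C < 7.3884 \<and>
      (\<forall>f\<in>class_S. taylor_coeff f 2 = 0 \<longrightarrow> norm (toeplitz_det 3 3 f) \<le> C))"
proof (intro conjI ballI impI exI[of _ "7.3883 :: real"])
  fix f assume f: "f \<in> class_S" "taylor_coeff f 2 = 0"
  \<comment> \<open>Everything follows from \<open>x\<^sup>2 + 2 y\<^sup>2 + 3 t\<^sup>2 \<le> 1\<close>, with room to spare. For the second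
      determinant, \<open>x \<le> 1\<close> and \<open>t \<le> 3 / 5\<close> (as \<open>1 / 3 < 9 / 25\<close>) give \<open>\<bar>a\<^sub>5\<bar> \<le> 8 / 5\<close>, so that
      both of its factors are at most \<open>1 + 8 / 5\<close>, and \<open>(13 / 5)\<^sup>2 = 6.76\<close>.\<close>
  define x y t where "x = norm (taylor_coeff f 3)" and "y = norm (taylor_coeff f 4)"
    and "t = norm (taylor_coeff f 5 - (taylor_coeff f 3)\<^sup>2)"
  have nonneg: "0 \<le> x" "0 \<le> y" "0 \<le> t" by (simp_all add: x_def y_def t_def)
  have main: "x\<^sup>2 + 2 * y\<^sup>2 + 3 * t\<^sup>2 \<le> 1"
    using class_S_coefficient_bound[OF f] by (simp add: x_def y_def t_def)
  have xy: "x\<^sup>2 + 2 * y\<^sup>2 \<le> 1" and x1: "x \<le> 1" and y1: "y \<le> 1"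
  proof -
    show "x\<^sup>2 + 2 * y\<^sup>2 \<le> 1" using main zero_le_power2[of t] by linarith
    then have "x\<^sup>2 \<le> 1\<^sup>2" "y\<^sup>2 \<le> 1\<^sup>2"
      using zero_le_power2[of x] zero_le_power2[of y] by (simp_all, linarith+)
    then show "x \<le> 1" "y \<le> 1" by (auto intro: power2_le_imp_le)
  qed
  show "norm (toeplitz_det 3 2 f) \<le> 4 / 3"
  proof -
    have "norm (toeplitz_det 3 2 f) = 2 * (x\<^sup>2 * y)"
      by (simp add: toeplitz_det_3 f x_def y_def norm_mult norm_power)
    also have "\<dots> \<le> 4 / 3"
    \<comment> \<open>If \<open>y\<close> is larger than \<open>2 / 3\<close>, then \<open>x\<^sup>2 \<le> 1 - 2 y\<^sup>2\<close> is small.\<close>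
    proof (cases "y \<le> 2 / 3")
      case True
      have "x\<^sup>2 * y \<le> 1 * (2 / 3)"
        using True x1 nonneg by (intro mult_mono power_le_one) auto
      then show ?thesis by linarith
    next
      case False
      then have "(2 / 3)\<^sup>2 \<le> y\<^sup>2" by (intro power_mono) auto
      then have "x\<^sup>2 \<le> 2 / 3" using xy by (simp add: power2_eq_square)
      then have "x\<^sup>2 * y \<le> (2 / 3) * 1"
        using y1 nonneg by (intro mult_mono) auto
      then show ?thesis by linarith
    qed
    finally show ?thesis .
  qed
  show "norm (toeplitz_det 3 3 f) \<le> 7.3883"
  proof -
    have "t\<^sup>2 \<le> 9 / 25"
      using main zero_le_power2[of x] zero_le_power2[of y] by linarith
    also have "9 / 25 = (3 / 5 :: real)\<^sup>2"
      by (simp add: power2_eq_square)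
    finally have "t\<^sup>2 \<le> (3 / 5)\<^sup>2" .
    then have t: "t \<le> 3 / 5" by (rule power2_le_imp_le) simp
    have a5: "norm (taylor_coeff f 5) \<le> 8 / 5"
    proof -
      have "norm (taylor_coeff f 5) \<le> t + norm ((taylor_coeff f 3)\<^sup>2)"
        unfolding t_def by (metis diff_add_cancel norm_triangle_ineq)
      also have "norm ((taylor_coeff f 3)\<^sup>2) \<le> 1"
        using x1 nonneg by (simp add: norm_power x_def power_le_one)
      finally show ?thesis using t by linarith
    qed
    have "norm (taylor_coeff f 3 - taylor_coeff f 5) \<le> x + norm (taylor_coeff f 5)"
      unfolding x_def by (rule norm_triangle_ineq4)
    then have 1: "norm (taylor_coeff f 3 - taylor_coeff f 5) \<le> 13 / 5"
      using x1 a5 by linarith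
    have "norm ((taylor_coeff f 3)\<^sup>2 - 2 * (taylor_coeff f 4)\<^sup>2 + taylor_coeff f 3 * taylor_coeff f 5)
        \<le> x\<^sup>2 + 2 * y\<^sup>2 + x * norm (taylor_coeff f 5)"
    proof -
      have "norm (u - v + w) \<le> norm u + norm v + norm w" for u v w :: complex
        by (meson add_right_mono norm_triangle_ineq norm_triangle_ineq4 order_trans)
      from this[of "(taylor_coeff f 3)\<^sup>2" "2 * (taylor_coeff f 4)\<^sup>2" "taylor_coeff f 3 * taylor_coeff f 5"]
      show ?thesis by (simp add: norm_mult norm_power x_def y_def)
    qed
    also have "x * norm (taylor_coeff f 5) \<le> 1 * (8 / 5)"
      using x1 a5 nonneg by (intro mult_mono) auto
    finally have 2: "norm ((taylor_coeff f 3)\<^sup>2 - 2 * (taylor_coeff f 4)\<^sup>2 + taylor_coeff f 3 * taylor_coeff f 5) \<le> 13 / 5"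
      using xy by linarith
    have "norm (toeplitz_det 3 3 f) \<le> 13 / 5 * (13 / 5)"
      unfolding toeplitz_det_3 norm_mult using 1 2 by (intro mult_mono) auto
    then show ?thesis by simp
  qed
qed auto

end
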